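(* Let $\Omega\subset\mathbb{C}^n$ be a smooth bounded pseudoconvex domain and let $\phi:\Omega\to\Omega$ be a holomorphic self-map. Suppose that the composition operator $C_\phi$ is compact on $A^2(\Omega)$. Then for every choice of radii $r_\zeta>0$ ($\zeta\in\Omega$) such that $B(\zeta,r_\zeta)\subset\Omega$ for all $\zeta\in\Omega$ and $r_\zeta\to0$ as $\zeta\to b\Omega$, and for every $p\in b\Omega$, $$\lim_{\zeta\in\Omega,\ \zeta\to p}\|K_{\phi(\zeta)}\|_{L^2(\Omega)}\,\bigl(V(B(\zeta,r_\zeta))\bigr)^{1/2}=0.$$
   Context: $b\Omega$ denotes the topological boundary of $\Omega$ and $V$ is Lebesgue volume measure. $A^2(\Omega)$ is the Bergman space of holomorphic functions $f:\Omega\to\mathbb{C}$ with $\int_\Omega|f|^2\,dV<\infty$, a Hilbert space with the $L^2(\Omega)$ norm. $K_z$ denotes the Bergman kernel of $\Omega$ at $z\in\Omega$, i.e. the element of $A^2(\Omega)$ with $f(z)=\langle f,K_z\rangle_{L^2(\Omega)}$ for all $f\in A^2(\Omega)$. $B(z,r)$ is the Euclidean ball centered at $z$ with radius $r$. For a holomorphic map $\phi:\Omega\to\Omega$, the composition operator is $C_\phi(f)=f\circ\phi$. A linear operator between Banach spaces is compact if the image of the open unit ball is relatively compact in norm. *)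

theory Defs
  imports "HOL-Analysis.Analysis"
begin

section \<open>Holomorphy in several variables\<close>

text \<open>
  A function on the total type \<open>complex ^ 'n\<close> stands for its restriction to an open set \<open>\<Omega>\<close>.
  It is holomorphic there if at each point it has a Frechet derivative that is complex linear
  (\<open>*s\<close> is multiplication of a vector by a complex scalar).
\<close>

definition holomorphic_fun_on :: "(complex ^ 'n \<Rightarrow> complex) \<Rightarrow> (complex ^ 'n::finite) set \<Rightarrow> bool"
  where "holomorphic_fun_on f \<Omega> \<longleftrightarrow>
    (\<forall>z\<in>\<Omega>. \<exists>L. (f has_derivative L) (at z) \<and> (\<forall>c v. L (c *s v) = c * L v))"

definition holomorphic_map_on ::
    "(complex ^ 'n \<Rightarrow> complex ^ 'm::finite) \<Rightarrow> (complex ^ 'n::finite) set \<Rightarrow> bool"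
  where "holomorphic_map_on \<phi> \<Omega> \<longleftrightarrow> (\<forall>i. holomorphic_fun_on (\<lambda>z. \<phi> z $ i) \<Omega>)"


section \<open>Smooth bounded pseudoconvex domains\<close>

text \<open>The set \<open>U\<close> is meant to be open in the next two definitions.\<close>

primrec C_times_on :: "nat \<Rightarrow> ('a::euclidean_space \<Rightarrow> real) \<Rightarrow> 'a set \<Rightarrow> bool"
  where
    "C_times_on 0 f U \<longleftrightarrow> continuous_on U f"
  | "C_times_on (Suc k) f U \<longleftrightarrow>
      (\<forall>x\<in>U. f differentiable (at x)) \<and>
      (\<forall>v. C_times_on k (\<lambda>x. frechet_derivative f (at x) v) U)"

definition C_infinity_on :: "('a::euclidean_space \<Rightarrow> real) \<Rightarrow> 'a set \<Rightarrow> bool"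
  where "C_infinity_on f U \<longleftrightarrow> (\<forall>k. C_times_on k f U)"

definition smooth_boundary :: "'a::euclidean_space set \<Rightarrow> bool"
  where "smooth_boundary \<Omega> \<longleftrightarrow>
    (\<forall>p\<in>frontier \<Omega>. \<exists>U \<rho>. open U \<and> p \<in> U \<and> C_infinity_on \<rho> U \<and>
       (\<forall>z\<in>U. \<exists>v. frechet_derivative \<rho> (at z) v \<noteq> 0) \<and>
       \<Omega> \<inter> U = {z \<in> U. \<rho> z < 0})"

text \<open>
  Continuous plurisubharmonic functions: the sub-mean value property on every closed complex
  disc \<open>{z + c w : \<bar>c\<bar> \<le> 1}\<close> contained in \<open>\<Omega>\<close>.
\<close>

definition continuous_psh_on :: "(complex ^ 'n \<Rightarrow> real) \<Rightarrow> (complex ^ 'n::finite) set \<Rightarrow> bool"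
  where "continuous_psh_on u \<Omega> \<longleftrightarrow>
    continuous_on \<Omega> u \<and>
    (\<forall>z w. (\<forall>c. cmod c \<le> 1 \<longrightarrow> z + c *s w \<in> \<Omega>) \<longrightarrow>
       u z \<le> integral {0..2 * pi} (\<lambda>t. u (z + cis t *s w)) / (2 * pi))"

text \<open>
  Pseudoconvexity is existence of a continuous plurisubharmonic exhaustion function. It is
  meaningful for arbitrary open sets; on smooth bounded domains it is equivalent to
  semidefiniteness of the Levi form.
\<close>

definition pseudoconvex :: "(complex ^ 'n::finite) set \<Rightarrow> bool"
  where "pseudoconvex \<Omega> \<longleftrightarrow>
    (\<exists>u. continuous_psh_on u \<Omega> \<and> (\<forall>c. compact {z \<in> \<Omega>. u z \<le> c}))"

definition smooth_bounded_pseudoconvex_domain :: "(complex ^ 'n::finite) set \<Rightarrow> bool"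
  where "smooth_bounded_pseudoconvex_domain \<Omega> \<longleftrightarrow>
    open \<Omega> \<and> connected \<Omega> \<and> \<Omega> \<noteq> {} \<and> bounded \<Omega> \<and> smooth_boundary \<Omega> \<and> pseudoconvex \<Omega>"


section \<open>The Bergman space\<close>

text \<open>
  Elements of the Bergman space are extended by \<open>0\<close> outside \<open>\<Omega>\<close>, so that each function on \<open>\<Omega>\<close>
  has exactly one representative, and distinct elements have positive distance.
\<close>

definition bergman_space :: "(complex ^ 'n::finite) set \<Rightarrow> (complex ^ 'n \<Rightarrow> complex) set"
  where "bergman_space \<Omega> =
    {f. holomorphic_fun_on f \<Omega> \<and>
        set_integrable lborel \<Omega> (\<lambda>z. (cmod (f z))\<^sup>2) \<and>
        (\<forall>z. z \<notin> \<Omega> \<longrightarrow> f z = 0)}"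

definition L2_inner ::
    "'a::euclidean_space set \<Rightarrow> ('a \<Rightarrow> complex) \<Rightarrow> ('a \<Rightarrow> complex) \<Rightarrow> complex"
  where "L2_inner \<Omega> f g = (LINT z:\<Omega>|lborel. f z * cnj (g z))"

definition L2_norm :: "'a::euclidean_space set \<Rightarrow> ('a \<Rightarrow> complex) \<Rightarrow> real"
  where "L2_norm \<Omega> f = sqrt (LINT z:\<Omega>|lborel. (cmod (f z))\<^sup>2)"

definition bergman_kernel :: "(complex ^ 'n::finite) set \<Rightarrow> complex ^ 'n \<Rightarrow> complex ^ 'n \<Rightarrow> complex"
  where "bergman_kernel \<Omega> z =
    (THE k. k \<in> bergman_space \<Omega> \<and> (\<forall>f\<in>bergman_space \<Omega>. f z = L2_inner \<Omega> f k))"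

definition bergman_topology :: "(complex ^ 'n::finite) set \<Rightarrow> (complex ^ 'n \<Rightarrow> complex) topology"
  where "bergman_topology \<Omega> =
    Metric_space.mtopology (bergman_space \<Omega>) (\<lambda>f g. L2_norm \<Omega> (\<lambda>z. f z - g z))"

definition composition_operator ::
    "(complex ^ 'n::finite) set \<Rightarrow> (complex ^ 'n \<Rightarrow> complex ^ 'n) \<Rightarrow>
     (complex ^ 'n \<Rightarrow> complex) \<Rightarrow> complex ^ 'n \<Rightarrow> complex"
  where "composition_operator \<Omega> \<phi> f = (\<lambda>z. if z \<in> \<Omega> then f (\<phi> z) else 0)"

text \<open>
  Compactness of a (linear) operator \<open>T\<close> on the Bergman space. That \<open>T\<close> maps the space into itself
  is part of the notion: it is not automatic for composition operators.
\<close>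

definition compact_on_bergman_space ::
    "(complex ^ 'n::finite) set \<Rightarrow>
     ((complex ^ 'n \<Rightarrow> complex) \<Rightarrow> (complex ^ 'n \<Rightarrow> complex)) \<Rightarrow> bool"
  where "compact_on_bergman_space \<Omega> T \<longleftrightarrow>
    T ` bergman_space \<Omega> \<subseteq> bergman_space \<Omega> \<and>
    compactin (bergman_topology \<Omega>)
      (bergman_topology \<Omega> closure_of (T ` {f \<in> bergman_space \<Omega>. L2_norm \<Omega> f < 1}))"

text \<open>The filter describing \<open>\<zeta> \<rightarrow> b\<Omega>\<close> for \<open>\<zeta>\<close> in \<open>\<Omega>\<close>, without fixing a boundary point.\<close>

definition to_boundary :: "'a::metric_space set \<Rightarrow> 'a filter"
  where "to_boundary \<Omega> =
    inf (filtercomap (\<lambda>\<zeta>. infdist \<zeta> (frontier \<Omega>)) (nhds 0)) (principal \<Omega>)"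

end

theory Submission
  imports Defs "HOL-Complex_Analysis.Complex_Analysis"
begin

text \<open>
  Since \<open>f (\<phi> \<zeta>) = (C\<^sub>\<phi> f) \<zeta>\<close>, the norm of the kernel at \<open>\<phi> \<zeta>\<close> is the supremum of \<open>\<bar>h \<zeta>\<bar>\<close>
  over the image \<open>h\<close> of the unit ball, and the mean value property bounds \<open>\<bar>h \<zeta>\<bar>\<close> times the root of
  the volume of \<open>B(\<zeta>, r\<^sub>\<zeta>)\<close> by the \<open>L\<^sup>2\<close> norm of \<open>h\<close> over that ball. By compactness, \<open>h\<close> is
  within \<open>\<epsilon>\<close> of one of finitely many functions, and the \<open>L\<^sup>2\<close> norm of each of these over a ball
  shrinking to \<open>p\<close> tends to \<open>0\<close> by dominated convergence.

  The kernel is obtained as the normalised element of least norm with value \<open>1\<close> at the point.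
\<close>

section \<open>Rotations and Lebesgue measure\<close>

lemma emeasure_lborel_orthogonal_image_le:
  fixes T :: "'a::euclidean_space \<Rightarrow> 'a"
  assumes T: "orthogonal_transformation T" and U: "open U"
  shows "emeasure lborel (T ` U) \<le> emeasure lborel U"
proof -
  txt \<open>
    Up to a null set, \<open>U\<close> is a disjoint union of balls (Vitali), and \<open>T\<close> maps balls to balls
    of the same radius.
  \<close>
  define K :: "('a \<times> real) set" where "K = {(x, d). 0 < d \<and> ball x d \<subseteq> U}"
  have cov: "\<exists>i. i \<in> K \<and> x \<in> ball (fst i) (snd i) \<and> snd i < d" if x: "x \<in> U" and d: "0 < d" for x d
  proof -
    obtain e where e: "0 < e" "ball x e \<subseteq> U" using openE[OF U x] by metis
    \<comment> \<open>The Vitali covering asks for balls of radius strictly below \<open>d\<close>,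
      hence the witness \<open>d/2\<close> instead of \<open>d\<close>.\<close>
    have "ball x (min e (d/2)) \<subseteq> U"
      using e(2) by (rule order_trans[OF subset_ball, rotated]) simp
    then have "(x, min e (d/2)) \<in> K" using e d unfolding K_def by simp
    then show ?thesis using e(1) d by (intro exI[of _ "(x, min e (d/2))"]) (simp add: min_less_iff_disj)
  qed
  obtain C where C: "countable C" "C \<subseteq> K"
    "pairwise (\<lambda>i j. disjnt (ball (fst i) (snd i)) (ball (fst j) (snd j))) C"
    "negligible (U - (\<Union>i\<in>C. ball (fst i) (snd i)))"
    using Vitali_covering_theorem_balls[of U K fst snd] cov by blast
  define N where "N = U - (\<Union>i\<in>C. ball (fst i) (snd i))"
  have lin: "linear T" using T by (rule orthogonal_transformation_linear)
  \<comment> \<open>An isometry is Lipschitz with constant 1, so it sends null sets to null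
    sets.\<close>
  have negT: "negligible (T ` N)"
  proof (rule negligible_locally_Lipschitz_image)
    show "negligible N" using C unfolding N_def by simp
    show "\<exists>S B. open S \<and> x \<in> S \<and> (\<forall>y\<in>N \<inter> S. norm (T y - T x) \<le> B * norm (y - x))" for x
      by (rule exI[of _ UNIV], rule exI[of _ 1])
        (use T in \<open>simp add: orthogonal_transformation_isometry flip: dist_norm\<close>)
  qed simp
  have sub: "T ` U \<subseteq> (\<Union>i\<in>C. ball (T (fst i)) (snd i)) \<union> T ` N"
  proof
    fix y assume "y \<in> T ` U"
    then obtain x where x: "x \<in> U" "y = T x" by blast
    have "dist (T a) (T x) = dist a x" for a
      using T by (simp add: orthogonal_transformation_isometry)
    with x show "y \<in> (\<Union>i\<in>C. ball (T (fst i)) (snd i)) \<union> T ` N"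
      unfolding N_def by (cases "x \<in> (\<Union>i\<in>C. ball (fst i) (snd i))") auto
  qed
  have opT: "open (T ` U)"
    using open_surjective_linear_image[OF U lin] orthogonal_transformation_surj[OF T] by blast
  have balls: "emeasure lborel (ball (T (fst i)) (snd i)) = emeasure lborel (ball (fst i) (snd i))"
    if "i \<in> C" for i
    using that C(2) by (subst (1 2) emeasure_ball) (auto simp: K_def)
  have disj: "disjoint_family_on (\<lambda>i. ball (T (fst i)) (snd i)) C"
    using C(3) orthogonal_transformation_inj[OF T]
    by (auto simp: disjoint_family_on_def pairwise_def disjnt_def
        simp flip: image_orthogonal_transformation_ball[OF T] image_Int)
  \<comment> \<open>The image of \<open>N\<close> is only known to be Lebesgue measurable, so the
    estimate passes through \<open>lebesgue\<close>; it returns to \<open>lborel\<close> once that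
    null set has been discarded.\<close>
  have "emeasure lborel (T ` U) = emeasure lebesgue (T ` U)"
    using opT by simp
  also have "\<dots> \<le> emeasure lebesgue ((\<Union>i\<in>C. ball (T (fst i)) (snd i)) \<union> T ` N)"
    using negT C(1) by (intro emeasure_mono[OF sub] sets.Un sets.countable_UN')
      (auto simp: negligible_imp_sets)
  also have "\<dots> \<le> emeasure lebesgue (\<Union>i\<in>C. ball (T (fst i)) (snd i)) + emeasure lebesgue (T ` N)"
    using negT C(1) by (intro emeasure_subadditive sets.countable_UN') (auto simp: negligible_imp_sets)
  also have "\<dots> = emeasure lborel (\<Union>i\<in>C. ball (T (fst i)) (snd i))"
    using negT negligible_iff_emeasure0[OF negligible_imp_sets[OF negT]]
    by (simp add: open_UN)
  also have "\<dots> = (\<integral>\<^sup>+i. emeasure lborel (ball (T (fst i)) (snd i)) \<partial>count_space C)"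
    using C(1) disj by (intro emeasure_UN_countable) auto
  also have "\<dots> = (\<integral>\<^sup>+i. emeasure lborel (ball (fst i) (snd i)) \<partial>count_space C)"
    by (intro nn_integral_cong) (simp add: balls)
  also have "\<dots> = emeasure lborel (\<Union>i\<in>C. ball (fst i) (snd i))"
    using C(1,3) by (intro emeasure_UN_countable[symmetric])
      (auto simp: disjoint_family_on_def pairwise_def disjnt_def)
  also have "\<dots> \<le> emeasure lborel U"
    using C(2) U by (intro emeasure_mono UN_least) (auto simp: K_def subset_eq)
  finally show ?thesis .
qed

text \<open>Applied to \<open>T\<close> and to \<open>inv T\<close>, the inequality for open sets
  becomes an equality on preimages of boxes, and the values on boxes determine Lebesgue
  measure.\<close>

lemma lborel_distr_orthogonal:
  fixes T :: "'a::euclidean_space \<Rightarrow> 'a"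
  assumes T: "orthogonal_transformation T"
  shows "distr lborel borel T = lborel"
proof (rule lborel_eqI[symmetric])
  fix l u :: 'a assume lu: "\<And>b. b \<in> Basis \<Longrightarrow> l \<bullet> b \<le> u \<bullet> b"
  have lin: "linear T" using T by (rule orthogonal_transformation_linear)
  then have cont: "continuous_on UNIV T" by (simp add: linear_continuous_on linear_conv_bounded_linear)
  then have meas: "T \<in> borel_measurable borel" by (rule borel_measurable_continuous_onI)
  have bij: "bij T" using T by (rule orthogonal_transformation_bij)
  have op: "open (T -` box l u)"
    using cont by (simp add: open_box open_vimage)
  have "emeasure lborel (T ` (T -` box l u)) \<le> emeasure lborel (T -` box l u)"
    by (rule emeasure_lborel_orthogonal_image_le[OF T op])
  moreover have "T ` (T -` box l u) = box l u"
    using bij by (simp add: bij_is_surj surj_image_vimage_eq)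
  moreover have "emeasure lborel (inv T ` box l u) \<le> emeasure lborel (box l u)"
    by (rule emeasure_lborel_orthogonal_image_le[OF orthogonal_transformation_inv[OF T] open_box])
  moreover have "inv T ` box l u = T -` box l u"
    using bij by (simp add: bij_vimage_eq_inv_image)
  ultimately have "emeasure lborel (T -` box l u) = emeasure lborel (box l u)" by simp
  then show "emeasure (distr lborel borel T) (box l u) = (\<Prod>b\<in>Basis. (u - l) \<bullet> b)"
    using lu meas by (simp add: emeasure_distr emeasure_lborel_box)
qed simp

section \<open>Mean values and limits of holomorphic functions\<close>

lemma norm_vector_smult:
  fixes v :: "complex ^ 'n::finite"
  shows "norm (c *s v) = cmod c * norm v"
  by (simp add: norm_vec_def L2_set_def norm_mult power_mult_distrib real_sqrt_mult flip: sum_distrib_left)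

lemma bounded_linear_smult_vec: "bounded_linear (\<lambda>c. c *s (v :: complex ^ 'n::finite))"
  by (rule bounded_linear_intro[of _ "norm v"])
    (simp_all add: norm_vector_smult vec_eq_iff algebra_simps)

lemma bounded_linear_vec_smult: "bounded_linear (\<lambda>v :: complex ^ 'n::finite. c *s v)"
  by (rule bounded_linear_intro[of _ "cmod c"])
    (simp_all add: norm_vector_smult vec_eq_iff algebra_simps)

lemma orthogonal_transformation_smult:
  assumes "cmod c = 1"
  shows "orthogonal_transformation (\<lambda>v :: complex ^ 'n::finite. c *s v)"
  using assms bounded_linear_vec_smult[of c]
  by (auto simp: orthogonal_transformation norm_vector_smult intro: bounded_linear.linear)

section \<open>Several-variable holomorphy and its restriction to complex lines\<close>

lemma holomorphic_fun_on_subset: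
  "holomorphic_fun_on f S \<Longrightarrow> T \<subseteq> S \<Longrightarrow> holomorphic_fun_on f T"
  unfolding holomorphic_fun_on_def by blast

lemma holomorphic_fun_on_const: "holomorphic_fun_on (\<lambda>z. a) S"
  unfolding holomorphic_fun_on_def by (intro ballI exI[of _ "\<lambda>v. 0"]) auto

lemma holomorphic_fun_on_add:
  assumes "holomorphic_fun_on f S" "holomorphic_fun_on g S"
  shows "holomorphic_fun_on (\<lambda>z. f z + g z) S"
  unfolding holomorphic_fun_on_def
proof
  fix z assume "z \<in> S"
  then obtain L M where "(f has_derivative L) (at z)" "\<And>c v. L (c *s v) = c * L v"
     "(g has_derivative M) (at z)" "\<And>c v. M (c *s v) = c * M v"
    using assms unfolding holomorphic_fun_on_def by metis
  then show "\<exists>L. ((\<lambda>z. f z + g z) has_derivative L) (at z) \<and> (\<forall>c v. L (c *s v) = c * L v)"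
    by (intro exI[of _ "\<lambda>v. L v + M v"]) (auto simp: distrib_left intro: has_derivative_add)
qed

lemma holomorphic_fun_on_mult:
  assumes "holomorphic_fun_on f S" "holomorphic_fun_on g S"
  shows "holomorphic_fun_on (\<lambda>z. f z * g z) S"
  unfolding holomorphic_fun_on_def
proof
  fix z assume "z \<in> S"
  then obtain L M where "(f has_derivative L) (at z)" "\<And>c v. L (c *s v) = c * L v"
     "(g has_derivative M) (at z)" "\<And>c v. M (c *s v) = c * M v"
    using assms unfolding holomorphic_fun_on_def by metis
  then show "\<exists>L. ((\<lambda>z. f z * g z) has_derivative L) (at z) \<and> (\<forall>c v. L (c *s v) = c * L v)"
    by (intro exI[of _ "\<lambda>v. f z * M v + L v * g z"])
      (auto simp: algebra_simps intro: has_derivative_eq_rhs[OF has_derivative_mult])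
qed

lemma holomorphic_fun_on_imp_continuous_on:
  "holomorphic_fun_on f S \<Longrightarrow> continuous_on S f"
  unfolding holomorphic_fun_on_def
  by (meson continuous_at_imp_continuous_on has_derivative_continuous)

text \<open>By the chain rule the derivative in \<open>c\<close> is
  \<open>h \<mapsto> L (h *s v)\<close>; complex linearity of \<open>L\<close> turns it into
  multiplication by \<open>L v\<close>. This gives access to one-variable function theory.\<close>

lemma has_field_derivative_complex_line:
  fixes f :: "complex ^ 'n::finite \<Rightarrow> complex"
  assumes "(f has_derivative L) (at (z + c *s v))" "\<And>c v. L (c *s v) = c * L v"
  shows "((\<lambda>c. f (z + c *s v)) has_field_derivative L v) (at c)"
proof -
  have "((\<lambda>c. z + c *s v) has_derivative (\<lambda>h. h *s v)) (at c)"
    by (auto intro!: derivative_eq_intros bounded_linear.has_derivative[OF bounded_linear_smult_vec])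
  from has_derivative_compose[OF this assms(1)]
  show ?thesis
    unfolding has_field_derivative_def by (rule has_derivative_eq_rhs) (simp add: assms(2) fun_eq_iff)
qed

lemma holomorphic_on_complex_line:
  assumes "holomorphic_fun_on f S" "\<And>c. c \<in> U \<Longrightarrow> z + c *s v \<in> S"
  shows "(\<lambda>c. f (z + c *s v)) holomorphic_on U"
  unfolding holomorphic_on_def field_differentiable_def
proof
  fix c assume "c \<in> U"
  then obtain L where "(f has_derivative L) (at (z + c *s v))" "\<And>c v. L (c *s v) = c * L v"
    using assms unfolding holomorphic_fun_on_def by metis
  then show "\<exists>D. ((\<lambda>c. f (z + c *s v)) has_field_derivative D) (at c within U)"
    using has_field_derivative_complex_line has_field_derivative_at_within by blast
qed

section \<open>Mean value inequalities, from circles to balls\<close>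

lemma norm_center_le_circle_integral:
  assumes f: "f holomorphic_on cball 0 1"
  shows "ennreal (cmod (f 0)) \<le> (\<integral>\<^sup>+t\<in>{0..1}. ennreal (cmod (f (cis (2 * pi * t)))) \<partial>lborel)"
proof -
  let ?g = "\<lambda>t::real. f (cis (2 * pi * t))"
  \<comment> \<open>Cauchy's formula on the unit circle, parametrised over the unit interval;
    dividing by \<open>2 * pi * \<i>\<close> leaves the mean of \<open>f\<close> over the
    circle.\<close>
  have "((\<lambda>u. f u / u) has_contour_integral (2 * of_real pi * \<i> * f 0)) (circlepath 0 1)"
    using Cauchy_integral_circlepath_simple[OF f, of 0] by simp
  then have "((\<lambda>t. f (exp (2 * of_real pi * \<i> * of_real t)) * (2 * of_real pi * \<i>))
      has_integral (2 * of_real pi * \<i> * f 0)) {0..1}"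
    unfolding has_contour_integral_def
    by (rule has_integral_eq_rhs[OF has_integral_eq, rotated])
      (auto simp: vector_derivative_circlepath01, auto simp: circlepath)
  from has_integral_mult_right[OF this, of "1 / (2 * of_real pi * \<i>)"]
  have int: "(?g has_integral f 0) {0..1}"
    by (simp add: cis_conv_exp mult_ac)
  have cont: "continuous_on {0..1} ?g"
    by (rule continuous_on_compose2[OF holomorphic_on_imp_continuous_on[OF f]])
      (auto intro!: continuous_intros)
  have contn: "continuous_on {0..1} (\<lambda>t. cmod (?g t))"
    using cont by (intro continuous_intros)
  have "cmod (f 0) \<le> integral {0..1} (\<lambda>t. cmod (?g t))"
    using integral_unique[OF int] cont contn
    by (metis integral_norm_bound_integral integrable_continuous_interval order_refl)
  moreover have "(\<integral>\<^sup>+t\<in>{0..1}. ennreal (cmod (?g t)) \<partial>lborel) = ennreal (integral {0..1} (\<lambda>t. cmod (?g t)))"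
    using contn by (intro nn_integral_has_integral_lebesgue' integrable_integral
        integrable_continuous_interval) auto
  ultimately show ?thesis by (simp add: ennreal_leI)
qed

lemma emeasure_ball_mult_center_le:
  fixes f :: "complex ^ 'n::finite \<Rightarrow> complex"
  assumes f: "holomorphic_fun_on f (ball z s)"
  shows "ennreal ((cmod (f z))\<^sup>2) * emeasure lborel (ball z s)
    \<le> (\<integral>\<^sup>+w\<in>ball z s. ennreal ((cmod (f w))\<^sup>2) \<partial>lborel)"
proof -
  \<comment> \<open>\<open>F\<close> is the squared modulus recentred at the origin and cut off
    outside the ball, so that all integrals run over the whole space, where the rotations
    act.\<close>
  define F where "F v = ennreal (indicator (ball z s) (z + v) * (cmod (f (z + v)))\<^sup>2)" for v
  have "(\<lambda>w. indicator (ball z s) w *\<^sub>R (cmod (f w))\<^sup>2) \<in> borel_measurable borel"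
    by (intro borel_measurable_continuous_on_indicator continuous_intros
        holomorphic_fun_on_imp_continuous_on[OF f]) auto
  then have G_meas: "(\<lambda>w. ennreal (indicator (ball z s) w * (cmod (f w))\<^sup>2)) \<in> borel_measurable borel"
    by simp
  have F_meas: "F \<in> borel_measurable borel"
    unfolding F_def by (rule measurable_compose[OF _ G_meas]) auto
  have rot: "continuous_on UNIV (\<lambda>p. cis (2 * pi * snd p) *s (fst p :: complex ^ 'n))"
    unfolding vector_scalar_mult_def by (intro continuous_intros)
  have "(\<lambda>p. F (cis (2 * pi * snd p) *s fst p)) \<in> borel_measurable borel"
    by (rule measurable_compose[OF borel_measurable_continuous_onI[OF rot] F_meas])
  moreover have "(\<lambda>p :: (complex ^ 'n) \<times> real. indicator {0..1} (snd p) :: ennreal) \<in> borel_measurable borel"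
    by (rule measurable_compose[OF borel_measurable_continuous_onI[of snd]])
      (auto intro!: continuous_intros)
  ultimately have meas: "(\<lambda>p. F (cis (2 * pi * snd p) *s fst p) * indicator {0..1} (snd p))
      \<in> borel_measurable (lborel \<Otimes>\<^sub>M lborel)"
    unfolding lborel_prod measurable_lborel2 by (rule borel_measurable_times_ennreal)
  txt \<open>
    Average the one-variable mean value inequality for \<open>f\<^sup>2\<close> on the disc \<open>{z + c v : \<bar>c\<bar> \<le> 1}\<close> over
    all \<open>v\<close>; the rotations \<open>v \<mapsto> e\<^sup>i\<^sup>t v\<close> preserve the ball and the measure.
  \<close>
  have pt: "ennreal ((cmod (f z))\<^sup>2) * indicator (ball 0 s) v
      \<le> (\<integral>\<^sup>+t. F (cis (2 * pi * t) *s v) * indicator {0..1} t \<partial>lborel)" for v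
  proof (cases "v \<in> ball 0 s")
    case True
    have sub: "z + c *s v \<in> ball z s" if "cmod c \<le> 1" for c
    proof -
      have "cmod c * norm v \<le> norm v" using that by (simp add: mult_left_le_one_le)
      then show ?thesis using True by (simp add: dist_norm norm_vector_smult)
    qed
    have "(\<lambda>c. f (z + c *s v) * f (z + c *s v)) holomorphic_on cball 0 1"
      by (intro holomorphic_intros holomorphic_on_complex_line[OF f] sub) auto
    from norm_center_le_circle_integral[OF this]
    have "ennreal ((cmod (f z))\<^sup>2) \<le>
      (\<integral>\<^sup>+t\<in>{0..1}. ennreal ((cmod (f (z + cis (2 * pi * t) *s v)))\<^sup>2) \<partial>lborel)"
      by (simp add: norm_mult power2_eq_square)
    also have "\<dots> = (\<integral>\<^sup>+t. F (cis (2 * pi * t) *s v) * indicator {0..1} t \<partial>lborel)"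
      unfolding F_def by (intro nn_integral_cong) (use sub in simp)
    finally show ?thesis using True by simp
  qed simp
  have rotF: "(\<integral>\<^sup>+v. F (cis (2 * pi * t) *s v) \<partial>lborel) = (\<integral>\<^sup>+v. F v \<partial>lborel)" for t
  proof -
    have "orthogonal_transformation (\<lambda>v :: complex ^ 'n. cis (2 * pi * t) *s v)"
      by (rule orthogonal_transformation_smult) simp
    note D = lborel_distr_orthogonal[OF this]
    have "(\<lambda>v :: complex ^ 'n. cis (2 * pi * t) *s v) \<in> borel_measurable borel"
      by (intro borel_measurable_continuous_onI linear_continuous_on bounded_linear_vec_smult)
    then show ?thesis
      using F_meas by (subst (2) D[symmetric], subst nn_integral_distr) simp_all
  qed
  have ball: "emeasure lborel (ball z s) = emeasure lborel (ball (0 :: complex ^ 'n) s)"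
  proof (cases "s \<ge> 0")
    case True then show ?thesis by (simp add: emeasure_ball)
  next
    case False then show ?thesis by (simp add: ball_empty)
  qed
  have "ennreal ((cmod (f z))\<^sup>2) * emeasure lborel (ball z s)
      = (\<integral>\<^sup>+v. ennreal ((cmod (f z))\<^sup>2) * indicator (ball 0 s) v \<partial>(lborel :: (complex ^ 'n) measure))"
    by (simp add: nn_integral_cmult_indicator ball)
  also have "\<dots> \<le> (\<integral>\<^sup>+v. (\<integral>\<^sup>+t. F (cis (2 * pi * t) *s v) * indicator {0..1} t \<partial>lborel) \<partial>lborel)"
    by (intro nn_integral_mono pt)
  \<comment> \<open>Tonelli's theorem: the integrand is nonnegative and jointly measurable. For
    fixed \<open>t\<close>, rotation invariance then makes the inner integral independent of
    \<open>t\<close>, and the parameter interval has length 1.\<close>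
  also have "\<dots> = (\<integral>\<^sup>+t. (\<integral>\<^sup>+v. F (cis (2 * pi * t) *s v) * indicator {0..1} t \<partial>lborel) \<partial>lborel)"
    using lborel_pair.Fubini'[of "\<lambda>v t. F (cis (2 * pi * t) *s v) * indicator {0..1} t"] meas
    by (simp add: case_prod_unfold)
  also have "\<dots> = (\<integral>\<^sup>+t. (\<integral>\<^sup>+v. F v \<partial>lborel) * indicator {0..1::real} t \<partial>lborel)"
  proof (intro nn_integral_cong)
    fix t :: real
    show "(\<integral>\<^sup>+v. F (cis (2 * pi * t) *s v) * indicator {0..1} t \<partial>lborel)
      = (\<integral>\<^sup>+v. F v \<partial>lborel) * indicator {0..1} t"
      using rotF[of t] by (cases "t \<in> {0..1}") simp_all
  qed
  also have "\<dots> = (\<integral>\<^sup>+v. F v \<partial>lborel)"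
    by (simp add: nn_integral_cmult_indicator)
  also have "\<dots> = (\<integral>\<^sup>+w. ennreal (indicator (ball z s) w * (cmod (f w))\<^sup>2) \<partial>lborel)"
    unfolding F_def using G_meas
    by (subst (2) lborel_distr_plus[of z, symmetric], subst nn_integral_distr) simp_all
  also have "\<dots> = (\<integral>\<^sup>+w\<in>ball z s. ennreal ((cmod (f w))\<^sup>2) \<partial>lborel)"
    by (intro nn_integral_cong) (simp add: indicator_def)
  finally show ?thesis .
qed

section \<open>Cauchy estimates and locally uniform limits\<close>

lemma holomorphic_fun_derivative_bound:
  assumes f: "holomorphic_fun_on f S" and S: "cball z d \<subseteq> S" and d: "0 < d"
    and B: "\<And>w. w \<in> cball z d \<Longrightarrow> cmod (f w) \<le> B"
    and L: "(f has_derivative L) (at z)" "\<And>c v. L (c *s v) = c * L v"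
  shows "cmod (L h) \<le> B / d * norm h"
proof (cases "h = 0")
  case True
  then show ?thesis using linear_0[OF has_derivative_linear[OF L(1)]] by simp
next
  case False
  \<comment> \<open>On the complex line through \<open>z\<close> in direction \<open>h\<close>, the
    ball of radius \<open>d\<close> becomes a disc of this radius; the one-variable Cauchy estimate
    at its centre bounds \<open>L h\<close>.\<close>
  let ?r = "d / norm h"
  have r: "?r > 0" using False d by simp
  have sub: "z + c *s h \<in> cball z d" if "cmod c \<le> ?r" for c
    using that False by (simp add: dist_norm norm_vector_smult field_simps)
  let ?g = "\<lambda>c. f (z + c *s h)"
  have hol: "?g holomorphic_on cball 0 ?r"
    using sub S by (intro holomorphic_on_complex_line[OF f]) (force simp: dist_norm)
  have "cmod ((deriv ^^ 1) ?g 0) \<le> fact 1 * B / ?r ^ 1"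
    using hol r by (intro Cauchy_inequality B sub) 
      (auto intro: holomorphic_on_subset holomorphic_on_imp_continuous_on)
  moreover have "deriv ?g 0 = L h"
    using L by (intro DERIV_imp_deriv has_field_derivative_complex_line) auto
  ultimately show ?thesis using False d by simp
qed

text \<open>Cauchy's estimate for the differences \<open>f m - f n\<close> makes the derivatives
  converge uniformly on a smaller ball. The theorem on derivatives of sequences then differentiates
  the limit, and complex linearity survives the pointwise limit.\<close>

lemma holomorphic_fun_on_uniform_limit:
  assumes f: "\<And>n. holomorphic_fun_on (f n) S"
    and lim: "\<And>z. z \<in> S \<Longrightarrow> \<exists>d>0. cball z d \<subseteq> S \<and> uniform_limit (cball z d) f g sequentially"
  shows "holomorphic_fun_on g S"
  unfolding holomorphic_fun_on_def
proof
  fix z assume "z \<in> S"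
  then obtain d where d: "d > 0" "cball z d \<subseteq> S" and ul: "uniform_limit (cball z d) f g sequentially"
    using lim by blast
  \<comment> \<open>Halving the radius keeps a ball of the fixed radius \<open>d/2\<close> around
    every point of \<open>X\<close> inside \<open>cball z d\<close>, so Cauchy's estimate has one
    constant for all these points.\<close>
  define X where "X = ball z (d/2)"
  have X: "cball x (d/2) \<subseteq> cball z d" if "x \<in> X" for x
  proof
    fix y assume "y \<in> cball x (d/2)"
    then show "y \<in> cball z d" using that dist_triangle[of z y x] by (simp add: X_def)
  qed
  have XS: "x \<in> S" if "x \<in> X" for x
    using subsetD[OF X[OF that], of x] d by auto
  obtain L where L: "\<And>n x. x \<in> S \<Longrightarrow> (f n has_derivative L n x) (at x)"
      "\<And>n x c v. x \<in> S \<Longrightarrow> L n x (c *s v) = c * L n x v"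
    using f unfolding holomorphic_fun_on_def by metis
  have diff: "\<exists>N. \<forall>m\<ge>N. \<forall>n\<ge>N. \<forall>x\<in>X. \<forall>h. norm (L m x h - L n x h) \<le> e * norm h" if "e > 0" for e
  proof -
    \<comment> \<open>Two errors below \<open>e * d / 4\<close> add up to \<open>e * d / 2\<close>,
      and Cauchy's estimate divides by \<open>d / 2\<close>, leaving \<open>e\<close>.\<close>
    have "e * d / 4 > 0" using that d by simp
    then obtain N where N: "\<And>n y. n \<ge> N \<Longrightarrow> y \<in> cball z d \<Longrightarrow> dist (f n y) (g y) < e * d / 4"
      using ul unfolding uniform_limit_sequentially_iff by blast
    have "norm (L m x h - L n x h) \<le> e * norm h" if mn: "m \<ge> N" "n \<ge> N" and x: "x \<in> X" for m n x h
    proof -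
      have "cmod (L m x h + - L n x h) \<le> (e * d / 2) / (d / 2) * norm h"
      proof (rule holomorphic_fun_derivative_bound[where S = S and f = "\<lambda>y. f m y + (-1) * f n y"])
        show "holomorphic_fun_on (\<lambda>y. f m y + - 1 * f n y) S"
          by (intro holomorphic_fun_on_add holomorphic_fun_on_mult holomorphic_fun_on_const f)
        show "cball x (d/2) \<subseteq> S" using X[OF x] d by blast
        show "cmod (f m w + - 1 * f n w) \<le> e * d / 2" if "w \<in> cball x (d/2)" for w
        proof -
          have "w \<in> cball z d" using X[OF x] that by blast
          from N[OF mn(1) this] N[OF mn(2) this] dist_triangle_half_l[of "f m w" "g w" "e * d / 2" "f n w"]
          show ?thesis by (simp add: dist_norm norm_minus_commute)
        qed
        show "((\<lambda>y. f m y + - 1 * f n y) has_derivative (\<lambda>h. L m x h + - L n x h)) (at x)"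
          using has_derivative_diff[OF L(1)[OF XS[OF x], of m] L(1)[OF XS[OF x], of n]] by simp
        show "L m x (c *s v) + - L n x (c *s v) = c * (L m x v + - L n x v)" for c v
          by (simp add: L(2)[OF XS[OF x]] algebra_simps)
      qed (use d in auto)
      then show ?thesis using d by simp
    qed
    then show ?thesis by blast
  qed
  have conv: "convergent (\<lambda>n. L n x h)" if x: "x \<in> X" for x h
  proof (rule Cauchy_convergent, rule metric_CauchyI)
    fix e :: real assume e: "e > 0"
    define e' where "e' = e / (norm h + 1)"
    have e': "e' > 0" "e' * norm h < e"
      using e by (auto simp: e'_def field_simps add_pos_nonneg)
    obtain N where "\<And>m n. m \<ge> N \<Longrightarrow> n \<ge> N \<Longrightarrow> norm (L m x h - L n x h) \<le> e' * norm h"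
      using diff[OF e'(1)] x by blast
    then show "\<exists>N. \<forall>m\<ge>N. \<forall>n\<ge>N. dist (L m x h) (L n x h) < e"
      using e'(2) by (intro exI[of _ N]) (auto simp: dist_norm intro: le_less_trans)
  qed
  define G where "G x h = lim (\<lambda>n. L n x h)" for x h
  have G: "(\<lambda>n. L n x h) \<longlonglongrightarrow> G x h" if "x \<in> X" for x h
    using conv[OF that] unfolding G_def by (simp add: convergent_LIMSEQ_iff)
  have z: "z \<in> X" using d by (simp add: X_def)
  have ptlim: "(\<lambda>n. f n x) \<longlonglongrightarrow> g x" if "x \<in> X" for x
    using tendsto_uniform_limitI[OF ul] that d by (auto simp: X_def)
  have "\<exists>g'. \<forall>x\<in>X. (\<lambda>n. f n x) \<longlonglongrightarrow> g' x \<and> (g' has_derivative G x) (at x within X)"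
  proof (rule has_derivative_sequence)
    show "convex X" by (simp add: X_def)
    show "(f n has_derivative L n x) (at x within X)" if "x \<in> X" for n x
      using L(1)[OF XS[OF that]] by (rule has_derivative_at_withinI)
    show "\<forall>\<^sub>F n in sequentially. \<forall>x\<in>X. \<forall>h. norm (L n x h - G x h) \<le> e * norm h" if e: "e > 0" for e
    proof -
      obtain N where N: "\<And>m n x h. m \<ge> N \<Longrightarrow> n \<ge> N \<Longrightarrow> x \<in> X \<Longrightarrow> norm (L n x h - L m x h) \<le> e * norm h"
        using diff[OF e] by blast
      have "norm (L n x h - G x h) \<le> e * norm h" if "n \<ge> N" "x \<in> X" for n x h
        by (rule tendsto_upperbound[OF tendsto_norm[OF tendsto_diff[OF tendsto_const G[OF that(2)]]]])
          (use N that in \<open>auto simp: eventually_sequentially intro!: exI[of _ N]\<close>)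
      then show ?thesis by (auto simp: eventually_sequentially)
    qed
  qed (use z ptlim in auto)
  then obtain g' where g': "\<And>x. x \<in> X \<Longrightarrow> (\<lambda>n. f n x) \<longlonglongrightarrow> g' x"
    "\<And>x. x \<in> X \<Longrightarrow> (g' has_derivative G x) (at x within X)" by blast
  have opX: "open X" by (simp add: X_def)
  \<comment> \<open>The sequence theorem supplies some limit function \<open>g'\<close>; uniqueness
    of pointwise limits identifies it with \<open>g\<close> on \<open>X\<close>.\<close>
  have "g' x = g x" if "x \<in> X" for x
    using g'(1) ptlim that LIMSEQ_unique by blast
  then have "(g has_derivative G z) (at z)"
    using g'(2)[OF z] at_within_open[OF z opX] has_derivative_transform_within_open[OF _ opX z] by metis
  moreover have "G z (c *s v) = c * G z v" for c v
    by (rule LIMSEQ_unique[OF G[OF z]]) (use G[OF z] L(2)[OF \<open>z \<in> S\<close>] in \<open>simp add: tendsto_mult_left\<close>)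
  ultimately show "\<exists>L. (g has_derivative L) (at z) \<and> (\<forall>c v. L (c *s v) = c * L v)" by blast
qed

section \<open>The Bergman space as a metric space\<close>

lemma L2_norm_nonneg [simp]: "0 \<le> L2_norm \<Omega> f"
  unfolding L2_norm_def set_lebesgue_integral_def by (simp add: integral_nonneg_AE)

lemma L2_norm_square: "(L2_norm \<Omega> f)\<^sup>2 = (LINT z:\<Omega>|lborel. (cmod (f z))\<^sup>2)"
  unfolding L2_norm_def set_lebesgue_integral_def by (simp add: integral_nonneg_AE)

lemma nn_integral_square_eq_L2_norm:
  assumes "set_integrable lborel \<Omega> (\<lambda>z. (cmod (f z))\<^sup>2)"
  shows "(\<integral>\<^sup>+z\<in>\<Omega>. ennreal ((cmod (f z))\<^sup>2) \<partial>lborel) = ennreal ((L2_norm \<Omega> f)\<^sup>2)"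
proof -
  have "(\<integral>\<^sup>+z\<in>\<Omega>. ennreal ((cmod (f z))\<^sup>2) \<partial>lborel)
     = (\<integral>\<^sup>+z. ennreal (indicator \<Omega> z *\<^sub>R (cmod (f z))\<^sup>2) \<partial>lborel)"
    by (intro nn_integral_cong) (simp add: indicator_def)
  also have "\<dots> = ennreal ((L2_norm \<Omega> f)\<^sup>2)"
    unfolding L2_norm_square set_lebesgue_integral_def
    using assms by (intro nn_integral_eq_integral) (auto simp: set_integrable_def)
  finally show ?thesis .
qed

lemma L2_inner_self:
  "L2_inner \<Omega> f f = of_real ((L2_norm \<Omega> f)\<^sup>2)"
  unfolding L2_inner_def L2_norm_square set_lebesgue_integral_def
  by (simp add: complex_norm_square[symmetric] scaleR_conv_of_real flip: of_real_mult of_real_power)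

lemma L2_inner_mult_right: "L2_inner \<Omega> f (\<lambda>z. c * g z) = cnj c * L2_inner \<Omega> f g"
proof -
  have "L2_inner \<Omega> f (\<lambda>z. c * g z) = (LINT z:\<Omega>|lborel. cnj c * (f z * cnj (g z)))"
    unfolding L2_inner_def by (simp add: algebra_simps)
  then show ?thesis by (simp add: L2_inner_def)
qed

lemma L2_norm_mult: "L2_norm \<Omega> (\<lambda>z. c * f z) = cmod c * L2_norm \<Omega> f"
  by (simp add: L2_norm_def norm_mult power_mult_distrib real_sqrt_mult)

lemma L2_norm_subset_le:
  assumes int: "set_integrable lborel V (\<lambda>z. (cmod (f z))\<^sup>2)"
    and sub: "U \<subseteq> V" and U: "U \<in> sets borel"
  shows "L2_norm U f \<le> L2_norm V f"
proof -
  have "set_integrable lborel U (\<lambda>z. (cmod (f z))\<^sup>2)"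
    using int sub U set_integrable_subset by (metis sets_lborel)
  with int show ?thesis
    unfolding L2_norm_def set_lebesgue_integral_def set_integrable_def
    using sub by (intro real_sqrt_le_mono integral_mono) (auto simp: indicator_def)
qed

lemma
  assumes "f \<in> bergman_space \<Omega>"
  shows bergman_space_holomorphic: "holomorphic_fun_on f \<Omega>"
    and bergman_space_integrable: "set_integrable lborel \<Omega> (\<lambda>z. (cmod (f z))\<^sup>2)"
    and bergman_space_outside: "z \<notin> \<Omega> \<Longrightarrow> f z = 0"
  using assms by (simp_all add: bergman_space_def)

lemma bergman_space_zero: "(\<lambda>z. 0) \<in> bergman_space \<Omega>"
  by (simp add: bergman_space_def holomorphic_fun_on_const set_integrable_def)

context
  fixes \<Omega> :: "(complex ^ 'n::finite) set"
  assumes op: "open \<Omega>"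
begin

text \<open>The arithmetic-geometric mean inequality dominates the product by the two integrable
  squares.\<close>

lemma bergman_space_prod_integrable:
  assumes f: "f \<in> bergman_space \<Omega>" and g: "g \<in> bergman_space \<Omega>"
  shows "set_integrable lborel \<Omega> (\<lambda>z. f z * cnj (g z))"
proof (rule set_integrable_bound)
  show "set_integrable lborel \<Omega> (\<lambda>z. (cmod (f z))\<^sup>2 + (cmod (g z))\<^sup>2)"
    using f g by (intro set_integral_add) (auto simp: bergman_space_def)
  have "continuous_on \<Omega> (\<lambda>z. f z * cnj (g z))"
    using f g by (intro continuous_intros holomorphic_fun_on_imp_continuous_on) (auto simp: bergman_space_def)
  then show "set_borel_measurable lborel \<Omega> (\<lambda>z. f z * cnj (g z))"
    unfolding set_borel_measurable_def measurable_lborel2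
    using op by (intro borel_measurable_continuous_on_indicator) auto
  have "cmod (f z * cnj (g z)) \<le> (cmod (f z))\<^sup>2 + (cmod (g z))\<^sup>2" for z
    using sum_squares_bound[of "cmod (f z)" "cmod (g z)"] mult_nonneg_nonneg[of "cmod (f z)" "cmod (g z)"]
    by (simp add: norm_mult del: mult_nonneg_nonneg)
  then show "AE z in lborel. z \<in> \<Omega> \<longrightarrow> norm (f z * cnj (g z)) \<le> norm ((cmod (f z))\<^sup>2 + (cmod (g z))\<^sup>2)"
    by (intro AE_I2) simp
qed

text \<open>The square is expanded under the integral. The free scalar \<open>c\<close> lets this
  one identity serve for Cauchy-Schwarz, for the parallelogram law and for variations around an
  element of least norm.\<close>

lemma
  assumes f: "f \<in> bergman_space \<Omega>" and g: "g \<in> bergman_space \<Omega>"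
  shows bergman_space_add_scaled: "(\<lambda>z. f z + c * g z) \<in> bergman_space \<Omega>"
    and L2_norm_add_scaled: "(L2_norm \<Omega> (\<lambda>z. f z + c * g z))\<^sup>2
      = (L2_norm \<Omega> f)\<^sup>2 + 2 * Re (c * L2_inner \<Omega> g f) + (cmod c)\<^sup>2 * (L2_norm \<Omega> g)\<^sup>2"
proof -
  have eq: "(cmod (f z + c * g z))\<^sup>2
      = (cmod (f z))\<^sup>2 + 2 * Re (c * (g z * cnj (f z))) + (cmod c)\<^sup>2 * (cmod (g z))\<^sup>2" for z
    unfolding cmod_power2 by (simp add: power2_eq_square algebra_simps)
  have hol: "holomorphic_fun_on f \<Omega>" "holomorphic_fun_on g \<Omega>"
    and int: "integrable lborel (\<lambda>z. indicator \<Omega> z *\<^sub>R (cmod (f z))\<^sup>2)"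
      "integrable lborel (\<lambda>z. indicator \<Omega> z *\<^sub>R (cmod (g z))\<^sup>2)"
    using f g by (auto simp: bergman_space_def set_integrable_def)
  have cross: "integrable lborel (\<lambda>z. indicator \<Omega> z *\<^sub>R (g z * cnj (f z)))"
    using bergman_space_prod_integrable[OF g f] by (simp add: set_integrable_def)
  have Re_cross: "integrable lborel (\<lambda>z. Re (c * (indicator \<Omega> z *\<^sub>R (g z * cnj (f z)))))"
    using cross by (intro integrable_Re integrable_mult_right)
  have split: "indicator \<Omega> z *\<^sub>R (cmod (f z + c * g z))\<^sup>2 = indicator \<Omega> z *\<^sub>R (cmod (f z))\<^sup>2
     + 2 * Re (c * (indicator \<Omega> z *\<^sub>R (g z * cnj (f z)))) + (cmod c)\<^sup>2 * (indicator \<Omega> z *\<^sub>R (cmod (g z))\<^sup>2)" for z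
    by (simp add: eq indicator_def)
  have "integrable lborel (\<lambda>z. indicator \<Omega> z *\<^sub>R (cmod (f z + c * g z))\<^sup>2)"
    unfolding split using int Re_cross by (intro Bochner_Integration.integrable_add integrable_mult_right)
  then show "(\<lambda>z. f z + c * g z) \<in> bergman_space \<Omega>"
    using hol f g unfolding bergman_space_def set_integrable_def
    by (auto intro!: holomorphic_fun_on_add holomorphic_fun_on_mult holomorphic_fun_on_const)
  have "(LINT z|lborel. Re (c * (indicator \<Omega> z *\<^sub>R (g z * cnj (f z))))) = Re (c * L2_inner \<Omega> g f)"
    unfolding L2_inner_def set_lebesgue_integral_def integral_Re[OF integrable_mult_right[OF cross]]
    by (simp only: integral_mult_right_zero)
  then show "(L2_norm \<Omega> (\<lambda>z. f z + c * g z))\<^sup>2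
      = (L2_norm \<Omega> f)\<^sup>2 + 2 * Re (c * L2_inner \<Omega> g f) + (cmod c)\<^sup>2 * (L2_norm \<Omega> g)\<^sup>2"
    unfolding L2_norm_square set_lebesgue_integral_def split
    using int Re_cross
    by (subst Bochner_Integration.integral_add Bochner_Integration.integral_add; auto intro!: integrable_mult_right)+
qed


lemma L2_inner_add_scaled_left:
  assumes "f \<in> bergman_space \<Omega>" "g \<in> bergman_space \<Omega>" "h \<in> bergman_space \<Omega>"
  shows "L2_inner \<Omega> (\<lambda>z. f z + c * g z) h = L2_inner \<Omega> f h + c * L2_inner \<Omega> g h"
proof -
  have "L2_inner \<Omega> (\<lambda>z. f z + c * g z) h = (LINT z:\<Omega>|lborel. f z * cnj (h z) + c * (g z * cnj (h z)))"
    unfolding L2_inner_def by (simp add: algebra_simps)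
  also have "\<dots> = L2_inner \<Omega> f h + c * L2_inner \<Omega> g h"
    unfolding L2_inner_def
    using assms by (subst set_integral_add) (auto intro!: set_integrable_mult_right bergman_space_prod_integrable)
  finally show ?thesis .
qed

lemma bergman_space_mult:
  assumes "f \<in> bergman_space \<Omega>"
  shows "(\<lambda>z. c * f z) \<in> bergman_space \<Omega>"
  using bergman_space_add_scaled[OF bergman_space_zero assms, of c] by simp

lemma bergman_space_diff:
  assumes "f \<in> bergman_space \<Omega>" "g \<in> bergman_space \<Omega>"
  shows "(\<lambda>z. f z - g z) \<in> bergman_space \<Omega>"
  using bergman_space_add_scaled[OF assms, of "-1"] by simp

text \<open>The right-hand side sees \<open>f\<close> only on the ball. This locality later lets the
  bound tend to 0 as the balls shrink to a boundary point.\<close>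

lemma bergman_mean_value_bound:
  assumes f: "f \<in> bergman_space \<Omega>" and sub: "ball z s \<subseteq> \<Omega>"
  shows "(cmod (f z))\<^sup>2 * measure lborel (ball z s) \<le> (L2_norm (ball z s) f)\<^sup>2"
proof -
  have hol: "holomorphic_fun_on f (ball z s)" and int: "set_integrable lborel (ball z s) (\<lambda>z. (cmod (f z))\<^sup>2)"
    using f sub holomorphic_fun_on_subset set_integrable_subset[OF _ _ sub, of lborel]
    by (auto simp: bergman_space_def)
  have "ennreal ((cmod (f z))\<^sup>2) * ennreal (measure lborel (ball z s)) \<le> ennreal ((L2_norm (ball z s) f)\<^sup>2)"
    using emeasure_ball_mult_center_le[OF hol] nn_integral_square_eq_L2_norm[OF int]
    by (simp add: emeasure_eq_ennreal_measure less_imp_neq[OF emeasure_lborel_ball_finite, unfolded infinity_ennreal_def])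
  then show ?thesis by (simp flip: ennreal_mult)
qed

text \<open>The volume of a ball does not depend on its centre, so the constant is the same for all
  \<open>z\<close> around which a ball of radius \<open>s\<close> fits; this turns norm convergence
  into locally uniform convergence.\<close>

lemma bergman_evaluation_bound:
  assumes f: "f \<in> bergman_space \<Omega>" and sub: "ball z s \<subseteq> \<Omega>" and s: "0 \<le> s"
  shows "(cmod (f z))\<^sup>2 * measure lborel (ball (0 :: complex ^ 'n) s) \<le> (L2_norm \<Omega> f)\<^sup>2"
proof -
  have "measure lborel (ball (0 :: complex ^ 'n) s) = measure lborel (ball z s)"
    using s by (simp add: measure_def emeasure_ball)
  moreover have "(L2_norm (ball z s) f)\<^sup>2 \<le> (L2_norm \<Omega> f)\<^sup>2"
    using f sub by (intro power_mono L2_norm_subset_le) (auto simp: bergman_space_def)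
  ultimately show ?thesis using order_trans[OF bergman_mean_value_bound[OF f sub]] by simp
qed

text \<open>The norm dominates evaluation at each point of \<open>\<Omega>\<close>, so norm 0 forces
  vanishing everywhere there and not merely almost everywhere; outside, the value 0 is built into
  the space.\<close>

lemma bergman_space_norm_eq_0:
  assumes f: "f \<in> bergman_space \<Omega>" and 0: "L2_norm \<Omega> f = 0"
  shows "f = (\<lambda>z. 0)"
proof
  fix z
  show "f z = 0"
  proof (cases "z \<in> \<Omega>")
    case True
    then obtain s where s: "0 < s" "ball z s \<subseteq> \<Omega>" using openE[OF op] by metis
    then have "(cmod (f z))\<^sup>2 * measure lborel (ball (0 :: complex ^ 'n) s) \<le> 0"
      using bergman_evaluation_bound[OF f s(2)] 0 by simp
    then show ?thesis using content_ball_pos[OF s(1), of "0 :: complex ^ 'n"] by (simp add: mult_le_0_iff)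
  qed (use f in \<open>simp add: bergman_space_def\<close>)
qed

lemma L2_norm_triangle:
  assumes f: "f \<in> bergman_space \<Omega>" and g: "g \<in> bergman_space \<Omega>"
  shows "L2_norm \<Omega> (\<lambda>z. f z + g z) \<le> L2_norm \<Omega> f + L2_norm \<Omega> g"
proof -
  let ?R = "Re (L2_inner \<Omega> g f)"
  have "?R \<le> L2_norm \<Omega> f * L2_norm \<Omega> g"
  proof (cases "L2_norm \<Omega> g = 0")
    case True
    then have "g = (\<lambda>z. 0)" using bergman_space_norm_eq_0[OF g] by simp
    then show ?thesis by (simp add: L2_inner_def)
  next
    case False
    \<comment> \<open>The squared norm of \<open>f + t g\<close> is a quadratic in the real variable
      \<open>t\<close> with its minimum here; nonnegativity of that minimum is Cauchy-Schwarz for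
      the real part.\<close>
    define t where "t = - ?R / (L2_norm \<Omega> g)\<^sup>2"
    have "0 \<le> (L2_norm \<Omega> f)\<^sup>2 + 2 * (t * ?R) + t\<^sup>2 * (L2_norm \<Omega> g)\<^sup>2"
      using L2_norm_add_scaled[OF f g, of "of_real t"]
        zero_le_power2[of "L2_norm \<Omega> (\<lambda>z. f z + of_real t * g z)"] by simp
    also have "\<dots> = (L2_norm \<Omega> f)\<^sup>2 - ?R\<^sup>2 / (L2_norm \<Omega> g)\<^sup>2"
      using False by (simp add: t_def field_simps power2_eq_square)
    finally have "?R\<^sup>2 \<le> (L2_norm \<Omega> f * L2_norm \<Omega> g)\<^sup>2"
      using False by (simp add: field_simps)
    then show ?thesis by (rule power2_le_imp_le) simp
  qed
  then have "(L2_norm \<Omega> (\<lambda>z. f z + g z))\<^sup>2 \<le> (L2_norm \<Omega> f + L2_norm \<Omega> g)\<^sup>2"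
    using L2_norm_add_scaled[OF f g, of 1] by (simp add: power2_sum)
  then show ?thesis by (rule power2_le_imp_le) simp
qed

lemma Metric_space_bergman:
  "Metric_space (bergman_space \<Omega>) (\<lambda>f g. L2_norm \<Omega> (\<lambda>z. f z - g z))"
proof
  fix f g h
  assume f: "f \<in> bergman_space \<Omega>" and g: "g \<in> bergman_space \<Omega>"
  show "L2_norm \<Omega> (\<lambda>z. f z - g z) = 0 \<longleftrightarrow> f = g"
  proof
    assume "L2_norm \<Omega> (\<lambda>z. f z - g z) = 0"
    from bergman_space_norm_eq_0[OF bergman_space_diff[OF f g] this]
    show "f = g" by (simp add: fun_eq_iff)
  qed (simp add: L2_norm_def)
  assume h: "h \<in> bergman_space \<Omega>"
  show "L2_norm \<Omega> (\<lambda>z. f z - h z) \<le> L2_norm \<Omega> (\<lambda>z. f z - g z) + L2_norm \<Omega> (\<lambda>z. g z - h z)"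
    using L2_norm_triangle[OF bergman_space_diff[OF f g] bergman_space_diff[OF g h]] by simp
qed (simp, simp add: L2_norm_def norm_minus_commute)

section \<open>The Bergman kernel\<close>

text \<open>By the evaluation bound, a sequence that is Cauchy in norm is uniformly Cauchy on small
  balls. Square integrability of the limit is not claimed; for minimising sequences it comes later
  from Fatou's lemma.\<close>

lemma bergman_locally_uniform_limit:
  assumes f: "\<And>n. f n \<in> bergman_space \<Omega>"
    and Cauchy: "\<And>e. 0 < e \<Longrightarrow> \<exists>N. \<forall>m\<ge>N. \<forall>n\<ge>N. L2_norm \<Omega> (\<lambda>z. f m z - f n z) < e"
  obtains g where "holomorphic_fun_on g \<Omega>" "\<And>z. (\<lambda>n. f n z) \<longlonglongrightarrow> g z"
proof -
  define g where "g z = lim (\<lambda>n. f n z)" for z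
  have unif: "\<exists>d>0. cball z d \<subseteq> \<Omega> \<and> uniform_limit (cball z d) f g sequentially" if z: "z \<in> \<Omega>" for z
  proof -
    obtain s where s: "0 < s" "ball z s \<subseteq> \<Omega>" using openE[OF op z] by metis
    define d where "d = s / 2"
    have d: "0 < d" using s by (simp add: d_def)
    have sub: "ball x d \<subseteq> \<Omega>" if "x \<in> cball z d" for x
    proof
      fix y assume "y \<in> ball x d"
      then have "dist z y < s" using that dist_triangle[of z y x] by (simp add: d_def)
      then show "y \<in> \<Omega>" using s by auto
    qed
    define \<mu> where "\<mu> = measure lborel (ball (0 :: complex ^ 'n) d)"
    have \<mu>: "0 < \<mu>" unfolding \<mu>_def by (rule content_ball_pos[OF d])
    have "uniformly_Cauchy_on (cball z d) f"
    proof (rule uniformly_Cauchy_onI)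
      fix e :: real assume e: "0 < e"
      \<comment> \<open>This threshold cancels the factor \<open>\<mu>\<close> of the evaluation
        bound and leaves \<open>e\<close>.\<close>
      then have "0 < e * sqrt \<mu>" using \<mu> by simp
      from Cauchy[OF this]
      obtain N where N: "\<And>m n. m \<ge> N \<Longrightarrow> n \<ge> N \<Longrightarrow> L2_norm \<Omega> (\<lambda>z. f m z - f n z) < e * sqrt \<mu>"
        by blast
      have "dist (f m x) (f n x) < e" if x: "x \<in> cball z d" and mn: "m \<ge> N" "n \<ge> N" for x m n
      proof -
        have "(cmod (f m x - f n x))\<^sup>2 * \<mu> \<le> (L2_norm \<Omega> (\<lambda>z. f m z - f n z))\<^sup>2"
          unfolding \<mu>_def
          using bergman_evaluation_bound[OF bergman_space_diff[OF f f] sub[OF x]] d by simp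
        also have "\<dots> < (e * sqrt \<mu>)\<^sup>2"
          using N[OF mn] by (intro power_strict_mono) auto
        finally have "(cmod (f m x - f n x))\<^sup>2 < e\<^sup>2"
          using \<mu> by (simp add: power_mult_distrib)
        then show ?thesis
          unfolding dist_norm using e by (intro power2_less_imp_less[of _ e]) auto
      qed
      then show "\<exists>N. \<forall>x\<in>cball z d. \<forall>m\<ge>N. \<forall>n\<ge>N. dist (f m x) (f n x) < e" by blast
    qed
    then have "uniform_limit (cball z d) f g sequentially"
      unfolding g_def uniformly_convergent_uniform_limit_iff[symmetric] by (rule Cauchy_uniformly_convergent)
    moreover have "cball z d \<subseteq> \<Omega>"
      using subsetD[OF sub centre_in_ball[THEN iffD2, OF d]] by (rule subsetI)
    ultimately show ?thesis using d by blast
  qed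
  have hol: "holomorphic_fun_on g \<Omega>"
    by (rule holomorphic_fun_on_uniform_limit[OF bergman_space_holomorphic[OF f] unif])
  have "(\<lambda>n. f n z) \<longlonglongrightarrow> g z" for z
  proof (cases "z \<in> \<Omega>")
    case True
    then obtain d where d: "0 < d" "uniform_limit (cball z d) f g sequentially" using unif by blast
    then show ?thesis using tendsto_uniform_limitI[OF d(2), of z] by simp
  next
    case False
    then have "f n z = 0" for n by (rule bergman_space_outside[OF f])
    then show ?thesis by (simp add: g_def)
  qed
  with hol show ?thesis by (rule that)
qed

text \<open>A minimising sequence in the convex set of elements with value 1 at \<open>w\<close> is
  Cauchy by the parallelogram law. Its pointwise limit keeps the value at \<open>w\<close>, and
  Fatou's lemma keeps its squared norm at most the infimum.\<close>

lemma bergman_minimal_norm_exists: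
  assumes h: "h \<in> bergman_space \<Omega>" "h w \<noteq> 0"
  obtains f where "f \<in> bergman_space \<Omega>" "f w = 1"
    "\<And>g. g \<in> bergman_space \<Omega> \<Longrightarrow> g w = 1 \<Longrightarrow> L2_norm \<Omega> f \<le> L2_norm \<Omega> g"
proof -
  define E where "E = {f \<in> bergman_space \<Omega>. f w = 1}"
  define I where "I = (INF f\<in>E. (L2_norm \<Omega> f)\<^sup>2)"
  have "(\<lambda>z. (1 / h w) * h z) \<in> E"
    using h bergman_space_mult[OF h(1), of "1 / h w"] by (simp add: E_def)
  then have ne: "E \<noteq> {}" by blast
  have bdd: "bdd_below ((\<lambda>f. (L2_norm \<Omega> f)\<^sup>2) ` E)" by (intro bdd_belowI[of _ 0]) auto
  have I_le: "I \<le> (L2_norm \<Omega> f)\<^sup>2" if "f \<in> E" for f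
    unfolding I_def by (rule cINF_lower[OF bdd that])
  have I_nonneg: "0 \<le> I" unfolding I_def by (rule cINF_greatest[OF ne]) simp
  have "\<exists>f\<in>E. (L2_norm \<Omega> f)\<^sup>2 < I + inverse (real (Suc n))" for n
    using cINF_less_iff[OF ne bdd, of "I + inverse (real (Suc n))"] unfolding I_def by simp
  then obtain f where fE: "\<And>n. f n \<in> E" and fI: "\<And>n. (L2_norm \<Omega> (f n))\<^sup>2 < I + inverse (real (Suc n))"
    by metis
  have fA: "f n \<in> bergman_space \<Omega>" for n using fE by (simp add: E_def)
  \<comment> \<open>The midpoint of \<open>a\<close> and \<open>b\<close> still lies in
    \<open>E\<close>, so its squared norm is at least \<open>I\<close>; the expansions at
    \<open>c = 1/2\<close> and \<open>c = 1\<close> together eliminate the inner product.\<close>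
  have parallelogram: "(L2_norm \<Omega> (\<lambda>z. b z - a z))\<^sup>2 \<le> 2 * (L2_norm \<Omega> a)\<^sup>2 + 2 * (L2_norm \<Omega> b)\<^sup>2 - 4 * I"
    if "a \<in> E" "b \<in> E" for a b
  proof -
    have A: "a \<in> bergman_space \<Omega>" "(\<lambda>z. b z - a z) \<in> bergman_space \<Omega>"
      using that by (auto simp: E_def intro: bergman_space_diff)
    have "(\<lambda>z. a z + (1/2) * (b z - a z)) \<in> E"
      using bergman_space_add_scaled[OF A, of "1/2"] that by (simp add: E_def)
    from I_le[OF this] L2_norm_add_scaled[OF A, of "1/2"] L2_norm_add_scaled[OF A, of 1]
    show ?thesis by (simp add: power_divide)
  qed
  have "\<exists>N. \<forall>m\<ge>N. \<forall>n\<ge>N. L2_norm \<Omega> (\<lambda>z. f m z - f n z) < e" if e: "0 < e" for e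
  proof -
    \<comment> \<open>Each squared norm exceeds \<open>I\<close> by less than
      \<open>inverse (real (Suc N))\<close>, so the parallelogram bound stays below four times that
      number, hence below \<open>e^2\<close>.\<close>
    obtain N where N: "inverse (real (Suc N)) < e\<^sup>2 / 4"
      using reals_Archimedean[of "e\<^sup>2 / 4"] e by auto
    have "L2_norm \<Omega> (\<lambda>z. f m z - f n z) < e" if "m \<ge> N" "n \<ge> N" for m n
    proof -
      have inv: "inverse (real (Suc k)) \<le> inverse (real (Suc N))" if "k \<ge> N" for k
        using that by (intro le_imp_inverse_le) auto
      have "(L2_norm \<Omega> (\<lambda>z. f m z - f n z))\<^sup>2 < e\<^sup>2"
        using parallelogram[OF fE[of n] fE[of m]] fI[of m] fI[of n] inv[OF that(1)] inv[OF that(2)] N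
        by linarith
      then show ?thesis using e by (intro power2_less_imp_less[of _ e]) auto
    qed
    then show ?thesis by blast
  qed
  from bergman_locally_uniform_limit[OF fA this] obtain g
    where g: "holomorphic_fun_on g \<Omega>" and lim: "\<And>z. (\<lambda>n. f n z) \<longlonglongrightarrow> g z" by metis
  have g0: "g z = 0" if "z \<notin> \<Omega>" for z
  proof -
    have "f n z = 0" for n by (rule bergman_space_outside[OF fA that])
    then show ?thesis using lim[of z] by (simp add: LIMSEQ_const_iff)
  qed
  have gw: "g w = 1"
  proof -
    have "f n w = 1" for n using fE by (simp add: E_def)
    then show ?thesis using lim[of w] by (simp add: LIMSEQ_const_iff)
  qed
  have meas: "(\<lambda>z. ennreal ((cmod (u z))\<^sup>2) * indicator \<Omega> z) \<in> borel_measurable lborel"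
    if "holomorphic_fun_on u \<Omega>" for u
  proof -
    have "(\<lambda>z. indicator \<Omega> z *\<^sub>R (cmod (u z))\<^sup>2) \<in> borel_measurable lborel"
      unfolding measurable_lborel2 using op that
      by (intro borel_measurable_continuous_on_indicator continuous_intros holomorphic_fun_on_imp_continuous_on) auto
    then have "(\<lambda>z. ennreal (indicator \<Omega> z *\<^sub>R (cmod (u z))\<^sup>2)) \<in> borel_measurable lborel" by simp
    then show ?thesis by (rule measurable_cong[THEN iffD1, rotated]) (simp add: indicator_def)
  qed
  \<comment> \<open>Fatou's lemma, in \<open>ennreal\<close> because integrability of the limit is
    still to be derived from the bound.\<close>
  have "(\<integral>\<^sup>+z\<in>\<Omega>. ennreal ((cmod (g z))\<^sup>2) \<partial>lborel)
      = (\<integral>\<^sup>+z. liminf (\<lambda>n. ennreal ((cmod (f n z))\<^sup>2) * indicator \<Omega> z) \<partial>lborel)"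
  proof (intro nn_integral_cong lim_imp_Liminf[symmetric])
    fix z
    have "(\<lambda>n. ennreal ((cmod (f n z))\<^sup>2)) \<longlonglongrightarrow> ennreal ((cmod (g z))\<^sup>2)"
      by (intro tendsto_intros lim)
    then show "(\<lambda>n. ennreal ((cmod (f n z))\<^sup>2) * indicator \<Omega> z) \<longlonglongrightarrow> ennreal ((cmod (g z))\<^sup>2) * indicator \<Omega> z"
      by (cases "z \<in> \<Omega>") auto
  qed simp
  also have "\<dots> \<le> liminf (\<lambda>n. \<integral>\<^sup>+z\<in>\<Omega>. ennreal ((cmod (f n z))\<^sup>2) \<partial>lborel)"
    by (intro nn_integral_liminf meas bergman_space_holomorphic fA)
  also have "\<dots> = liminf (\<lambda>n. ennreal ((L2_norm \<Omega> (f n))\<^sup>2))"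
    by (simp only: nn_integral_square_eq_L2_norm[OF bergman_space_integrable[OF fA]])
  also have "\<dots> \<le> liminf (\<lambda>n. ennreal (I + inverse (real (Suc n))))"
    using fI by (intro Liminf_mono always_eventually allI ennreal_leI less_imp_le)
  also have "\<dots> = ennreal I"
    by (intro lim_imp_Liminf tendsto_ennrealI)
      (use tendsto_add[OF tendsto_const[of I] LIMSEQ_inverse_real_of_nat] in auto)
  finally have bound: "(\<integral>\<^sup>+z\<in>\<Omega>. ennreal ((cmod (g z))\<^sup>2) \<partial>lborel) \<le> ennreal I" .
  have int: "set_integrable lborel \<Omega> (\<lambda>z. (cmod (g z))\<^sup>2)"
    unfolding set_integrable_def
  proof (rule integrableI_bounded)
    show "(\<lambda>z. indicator \<Omega> z *\<^sub>R (cmod (g z))\<^sup>2) \<in> borel_measurable lborel"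
      unfolding measurable_lborel2 using op g
      by (intro borel_measurable_continuous_on_indicator continuous_intros holomorphic_fun_on_imp_continuous_on) auto
    have "(\<integral>\<^sup>+z. ennreal (norm (indicator \<Omega> z *\<^sub>R (cmod (g z))\<^sup>2)) \<partial>lborel)
      = (\<integral>\<^sup>+z\<in>\<Omega>. ennreal ((cmod (g z))\<^sup>2) \<partial>lborel)"
      by (intro nn_integral_cong) (simp add: indicator_def)
    also have "\<dots> < \<infinity>" using le_less_trans[OF bound] by simp
    finally show "(\<integral>\<^sup>+z. ennreal (norm (indicator \<Omega> z *\<^sub>R (cmod (g z))\<^sup>2)) \<partial>lborel) < \<infinity>" .
  qed
  have gA: "g \<in> bergman_space \<Omega>" using g g0 int by (simp add: bergman_space_def)
  have gI: "(L2_norm \<Omega> g)\<^sup>2 \<le> I"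
    using bound I_nonneg unfolding nn_integral_square_eq_L2_norm[OF int] by simp
  show ?thesis
  proof (rule that[OF gA gw])
    fix u assume "u \<in> bergman_space \<Omega>" "u w = 1"
    then have "I \<le> (L2_norm \<Omega> u)\<^sup>2" by (intro I_le) (simp add: E_def)
    with gI have "(L2_norm \<Omega> g)\<^sup>2 \<le> (L2_norm \<Omega> u)\<^sup>2" by (rule order_trans)
    then show "L2_norm \<Omega> g \<le> L2_norm \<Omega> u" by (rule power2_le_imp_le) simp
  qed
qed

text \<open>An element of least norm with value 1 at \<open>w\<close> is orthogonal to every element
  vanishing at \<open>w\<close>; dividing it by its squared norm gives the Riesz representer of
  evaluation.\<close>

lemma reproducing_kernel_exists:
  "\<exists>k\<in>bergman_space \<Omega>. \<forall>f\<in>bergman_space \<Omega>. f w = L2_inner \<Omega> f k"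
proof (cases "\<exists>h\<in>bergman_space \<Omega>. h w \<noteq> 0")
  case False
  \<comment> \<open>If every element vanishes at \<open>w\<close>, in particular for
    \<open>w\<close> outside \<open>\<Omega>\<close>, the zero function represents
    evaluation.\<close>
  then show ?thesis
    by (intro bexI[OF _ bergman_space_zero]) (auto simp: L2_inner_def)
next
  case True
  then obtain f where f: "f \<in> bergman_space \<Omega>" "f w = 1" and
    min: "\<And>g. g \<in> bergman_space \<Omega> \<Longrightarrow> g w = 1 \<Longrightarrow> L2_norm \<Omega> f \<le> L2_norm \<Omega> g"
    using bergman_minimal_norm_exists by metis
  have orth: "L2_inner \<Omega> g f = 0" if g: "g \<in> bergman_space \<Omega>" "g w = 0" for g
  proof (rule ccontr)
    define a where "a = L2_inner \<Omega> g f"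
    \<comment> \<open>With \<open>c = - s * cnj a\<close> the squared norm changes by
      \<open>s |a|^2 (s ||g||^2 - 2)\<close>, which is negative because
      \<open>s ||g||^2 < 1\<close>. The added 1 keeps the denominator positive when \<open>g\<close>
      has norm 0.\<close>
    define s where "s = 1 / ((L2_norm \<Omega> g)\<^sup>2 + 1)"
    assume "L2_inner \<Omega> g f \<noteq> 0"
    then have a: "0 < (cmod a)\<^sup>2" by (simp add: a_def)
    have s: "0 < s" "s * (L2_norm \<Omega> g)\<^sup>2 < 1"
      by (auto simp: s_def add_nonneg_pos)
    define c where "c = - of_real s * cnj a"
    have "L2_norm \<Omega> f \<le> L2_norm \<Omega> (\<lambda>z. f z + c * g z)"
      using f g by (intro min bergman_space_add_scaled) auto
    then have "(L2_norm \<Omega> f)\<^sup>2 \<le> (L2_norm \<Omega> (\<lambda>z. f z + c * g z))\<^sup>2" by (intro power_mono) auto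
    then have *: "0 \<le> 2 * Re (c * a) + (cmod c)\<^sup>2 * (L2_norm \<Omega> g)\<^sup>2"
      using L2_norm_add_scaled[OF f(1) g(1), of c] by (simp add: a_def)
    have Re_ca: "Re (c * a) = - s * (cmod a)\<^sup>2"
      unfolding cmod_power2 by (simp add: c_def power2_eq_square algebra_simps)
    have norm_c: "(cmod c)\<^sup>2 = s\<^sup>2 * (cmod a)\<^sup>2"
      using s by (simp add: c_def norm_mult power_mult_distrib)
    have "0 \<le> (s * (cmod a)\<^sup>2) * (s * (L2_norm \<Omega> g)\<^sup>2 - 2)"
      using * unfolding Re_ca norm_c by (simp add: power2_eq_square algebra_simps)
    moreover have "0 < s * (cmod a)\<^sup>2" using s a by simp
    ultimately show False using s(2) by (simp add: zero_le_mult_iff)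
  qed
  have pos: "L2_norm \<Omega> f \<noteq> 0"
    using bergman_space_norm_eq_0[OF f(1)] f(2) by auto
  define k where "k z = of_real (1 / (L2_norm \<Omega> f)\<^sup>2) * f z" for z
  have "g w = L2_inner \<Omega> g k" if g: "g \<in> bergman_space \<Omega>" for g
  proof -
    \<comment> \<open>Since \<open>f w = 1\<close>, subtracting \<open>g w * f\<close> from
      \<open>g\<close> leaves an element vanishing at \<open>w\<close>, to which orthogonality
      applies.\<close>
    have "L2_inner \<Omega> (\<lambda>z. g z + (- g w) * f z) f = 0"
      using f g by (intro orth bergman_space_add_scaled) auto
    then have "L2_inner \<Omega> g f = g w * of_real ((L2_norm \<Omega> f)\<^sup>2)"
      using L2_inner_add_scaled_left[OF g f(1) f(1), of "- g w"] L2_inner_self[of \<Omega> f] by simp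
    then show ?thesis
      unfolding k_def L2_inner_mult_right using pos by simp
  qed
  moreover have "k \<in> bergman_space \<Omega>"
    unfolding k_def by (rule bergman_space_mult[OF f(1)])
  ultimately show ?thesis by blast
qed

lemma
  shows bergman_kernel_in_space: "bergman_kernel \<Omega> w \<in> bergman_space \<Omega>"
    and bergman_kernel_reproducing:
      "\<And>f. f \<in> bergman_space \<Omega> \<Longrightarrow> f w = L2_inner \<Omega> f (bergman_kernel \<Omega> w)"
proof -
  let ?P = "\<lambda>k. k \<in> bergman_space \<Omega> \<and> (\<forall>f\<in>bergman_space \<Omega>. f w = L2_inner \<Omega> f k)"
  have "\<exists>!k. ?P k"
  proof (rule ex_ex1I)
    show "\<exists>k. ?P k" using reproducing_kernel_exists by blast
    fix k l assume k: "?P k" and l: "?P l"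
    \<comment> \<open>For reproducing elements the squared distance is a difference of squared
      norms. It is nonnegative in both orders, hence 0, which gives the uniqueness demanded by the
      definite description.\<close>
    have k_diff: "(L2_norm \<Omega> (\<lambda>z. f z + (- 1) * g z))\<^sup>2 = (L2_norm \<Omega> f)\<^sup>2 - (L2_norm \<Omega> g)\<^sup>2"
      if f: "?P f" and g: "?P g" for f g
    proof -
      have "g w = L2_inner \<Omega> g f" "g w = L2_inner \<Omega> g g"
        using bspec[OF conjunct2[OF f] conjunct1[OF g]] bspec[OF conjunct2[OF g] conjunct1[OF g]] .
      then have "L2_inner \<Omega> g f = of_real ((L2_norm \<Omega> g)\<^sup>2)" by (simp add: L2_inner_self)
      then show ?thesis
        using L2_norm_add_scaled[OF conjunct1[OF f] conjunct1[OF g], of "- 1"] by simp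
    qed
    have "(L2_norm \<Omega> (\<lambda>z. k z + (- 1) * l z))\<^sup>2 = 0"
      using k_diff[OF k l] k_diff[OF l k] zero_le_power2[of "L2_norm \<Omega> (\<lambda>z. k z + (- 1) * l z)"]
        zero_le_power2[of "L2_norm \<Omega> (\<lambda>z. l z + (- 1) * k z)"] by linarith
    then have "L2_norm \<Omega> (\<lambda>z. k z - l z) = 0" by simp
    from bergman_space_norm_eq_0[OF bergman_space_diff[OF conjunct1[OF k] conjunct1[OF l]] this]
    show "k = l" by (simp add: fun_eq_iff)
  qed
  from theI'[OF this, folded bergman_kernel_def]
  show "bergman_kernel \<Omega> w \<in> bergman_space \<Omega>"
    and "\<And>f. f \<in> bergman_space \<Omega> \<Longrightarrow> f w = L2_inner \<Omega> f (bergman_kernel \<Omega> w)"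
    by simp_all
qed

end

text \<open>The test function is \<open>k / (2 * N)\<close>: it has norm \<open>1/2\<close> and
  value \<open>N / 2\<close> at \<open>w\<close>, because \<open>k w = N^2\<close>. The factor 2
  pays for staying inside the open unit ball.\<close>

lemma bergman_kernel_norm_bound:
  assumes op: "open \<Omega>" and c: "0 \<le> c"
    and bound: "\<And>f. f \<in> bergman_space \<Omega> \<Longrightarrow> L2_norm \<Omega> f < 1 \<Longrightarrow> cmod (f w) * c \<le> M"
  shows "L2_norm \<Omega> (bergman_kernel \<Omega> w) * c \<le> 2 * M"
proof (cases "L2_norm \<Omega> (bergman_kernel \<Omega> w) = 0")
  case True
  \<comment> \<open>The zero function as test function yields \<open>0 \<le> M\<close>.\<close>
  then show ?thesis using bound[OF bergman_space_zero] by (simp add: L2_norm_def)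
next
  case False
  define k where "k = bergman_kernel \<Omega> w"
  define N where "N = L2_norm \<Omega> k"
  have N: "0 < N" 
    using False L2_norm_nonneg[of \<Omega> k] unfolding N_def k_def by linarith
  have k: "k \<in> bergman_space \<Omega>" unfolding k_def by (rule bergman_kernel_in_space[OF op])
  have kw: "k w = of_real (N\<^sup>2)"
    using bergman_kernel_reproducing[OF op k, of w] by (simp add: k_def N_def L2_inner_self)
  have "L2_norm \<Omega> (\<lambda>z. of_real (1 / (2 * N)) * k z) = 1 / 2"
    unfolding L2_norm_mult norm_of_real using N by (simp flip: N_def)
  then have "cmod (of_real (1 / (2 * N)) * k w) * c \<le> M"
    by (intro bound bergman_space_mult[OF op k]) simp
  moreover have "cmod (of_real (1 / (2 * N)) * k w) = N / 2"
    unfolding kw of_real_mult[symmetric] norm_of_real using N by (simp add: power2_eq_square)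
  ultimately have "N / 2 * c \<le> M" by (simp only:)
  then show ?thesis by (simp add: N_def k_def)
qed

section \<open>Compact composition operators\<close>

text \<open>The small balls eventually lie in the trace on \<open>\<Omega>\<close> of any fixed ball
  around \<open>p\<close>. These traces shrink to the empty set because \<open>p\<close> is outside
  \<open>\<Omega>\<close>, so dominated convergence sends the norms over them to 0.\<close>

lemma L2_norm_ball_tendsto_0:
  assumes int: "set_integrable lborel \<Omega> (\<lambda>z. (cmod (g z))\<^sup>2)" and \<Omega>: "\<Omega> \<in> sets borel"
    and r: "(r \<longlongrightarrow> 0) (at p within \<Omega>)" and sub: "\<And>\<zeta>. \<zeta> \<in> \<Omega> \<Longrightarrow> ball \<zeta> (r \<zeta>) \<subseteq> \<Omega>"
    and p: "p \<notin> \<Omega>"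
  shows "((\<lambda>\<zeta>. L2_norm (ball \<zeta> (r \<zeta>)) g) \<longlongrightarrow> 0) (at p within \<Omega>)"
proof (rule tendstoI)
  fix e :: real assume e: "0 < e"
  define U where "U n = ball p (inverse (real (Suc n))) \<inter> \<Omega>" for n
  have U_sets: "U n \<in> sets borel" for n using \<Omega> by (simp add: U_def)
  have intU: "set_integrable lborel (U n) (\<lambda>z. (cmod (g z))\<^sup>2)" for n
    using set_integrable_subset[OF int, of "U n"] U_sets by (simp add: U_def)
  have "(\<lambda>n. LINT z|lborel. indicator (U n) z *\<^sub>R (cmod (g z))\<^sup>2) \<longlonglongrightarrow> (LINT z|(lborel :: 'a measure). 0)"
  proof (rule integral_dominated_convergence)
    show "integrable lborel (\<lambda>z. indicator \<Omega> z *\<^sub>R (cmod (g z))\<^sup>2)"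
      using int by (simp add: set_integrable_def)
    show "(\<lambda>z. indicator (U n) z *\<^sub>R (cmod (g z))\<^sup>2) \<in> borel_measurable lborel" for n
      using intU[of n] unfolding set_integrable_def by (rule borel_measurable_integrable)
    show "AE z in lborel. (\<lambda>n. indicator (U n) z *\<^sub>R (cmod (g z))\<^sup>2) \<longlonglongrightarrow> 0"
    proof (intro AE_I2 tendsto_eventually)
      fix z
      show "\<forall>\<^sub>F n in sequentially. indicator (U n) z *\<^sub>R (cmod (g z))\<^sup>2 = 0"
      proof (cases "z \<in> \<Omega>")
        case True
        then have "0 < dist p z" using p by auto
        then have "\<forall>\<^sub>F n in sequentially. inverse (real (Suc n)) < dist p z"
          using order_tendstoD(2)[OF LIMSEQ_inverse_real_of_nat] by blast
        then show ?thesis by eventually_elim (simp add: U_def)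
      qed (simp add: U_def)
    qed
  qed (auto simp: U_def indicator_def)
  then have "(\<lambda>n. L2_norm (U n) g) \<longlonglongrightarrow> 0"
    unfolding L2_norm_def set_lebesgue_integral_def using tendsto_real_sqrt by force
  then obtain n where n: "L2_norm (U n) g < e"
    using order_tendstoD(2)[OF _ e] by (metis eventually_happens' sequentially_bot)
  let ?d = "inverse (real (Suc n))"
  \<comment> \<open>Half of the radius \<open>?d\<close> is reserved for the distance from
    \<open>\<zeta>\<close> to \<open>p\<close>, the other half for \<open>r \<zeta>\<close>.\<close>
  have "\<forall>\<^sub>F \<zeta> in at p within \<Omega>. \<zeta> \<in> \<Omega>" by (simp add: eventually_at_filter)
  moreover have "\<forall>\<^sub>F \<zeta> in at p within \<Omega>. dist \<zeta> p < ?d / 2"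
    by (intro tendstoD[OF tendsto_ident_at]) simp
  moreover have "\<forall>\<^sub>F \<zeta> in at p within \<Omega>. r \<zeta> < ?d / 2"
    by (intro order_tendstoD(2)[OF r]) simp
  ultimately show "\<forall>\<^sub>F \<zeta> in at p within \<Omega>. dist (L2_norm (ball \<zeta> (r \<zeta>)) g) 0 < e"
  proof eventually_elim
    case (elim \<zeta>)
    have "dist p y < ?d" if "dist \<zeta> y < r \<zeta>" for y
      using that elim dist_triangle[of p y \<zeta>] by (simp add: dist_commute)
    then have "ball \<zeta> (r \<zeta>) \<subseteq> U n" using sub[OF elim(1)] by (auto simp: U_def)
    then have "L2_norm (ball \<zeta> (r \<zeta>)) g \<le> L2_norm (U n) g"
      by (intro L2_norm_subset_le intU) auto
    with n show ?case by simp
  qed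
qed

text \<open>The distance to the frontier is continuous and vanishes at \<open>p\<close>, so
  approaching a fixed \<open>p\<close> inside \<open>\<Omega>\<close> is one way of approaching the
  boundary.\<close>

lemma at_within_le_to_boundary:
  assumes "p \<in> frontier \<Omega>"
  shows "at p within \<Omega> \<le> to_boundary \<Omega>"
proof -
  have "((\<lambda>\<zeta>. infdist \<zeta> (frontier \<Omega>)) \<longlongrightarrow> infdist p (frontier \<Omega>)) (at p within \<Omega>)"
    by (intro tendsto_intros)
  then have "((\<lambda>\<zeta>. infdist \<zeta> (frontier \<Omega>)) \<longlongrightarrow> 0) (at p within \<Omega>)"
    using assms by simp
  then have "at p within \<Omega> \<le> filtercomap (\<lambda>\<zeta>. infdist \<zeta> (frontier \<Omega>)) (nhds 0)"
    by (simp add: filterlim_iff_le_filtercomap)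
  moreover have "at p within \<Omega> \<le> principal \<Omega>"
    by (simp add: at_within_def le_infI2)
  ultimately show ?thesis by (simp add: to_boundary_def)
qed

theorem theorem2:
  fixes \<Omega> :: "(complex ^ 'n::finite) set"
    and \<phi> :: "complex ^ 'n \<Rightarrow> complex ^ 'n"
    and r :: "complex ^ 'n \<Rightarrow> real"
    and p :: "complex ^ 'n"
  assumes "smooth_bounded_pseudoconvex_domain \<Omega>"
    and "holomorphic_map_on \<phi> \<Omega>"
    and "\<phi> ` \<Omega> \<subseteq> \<Omega>"
    and "compact_on_bergman_space \<Omega> (composition_operator \<Omega> \<phi>)"
    and "\<And>\<zeta>. \<zeta> \<in> \<Omega> \<Longrightarrow> 0 < r \<zeta>"
    and "\<And>\<zeta>. \<zeta> \<in> \<Omega> \<Longrightarrow> ball \<zeta> (r \<zeta>) \<subseteq> \<Omega>"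
    and "(r \<longlongrightarrow> 0) (to_boundary \<Omega>)"
    and "p \<in> frontier \<Omega>"
  shows "((\<lambda>\<zeta>. L2_norm \<Omega> (bergman_kernel \<Omega> (\<phi> \<zeta>)) * sqrt (measure lborel (ball \<zeta> (r \<zeta>))))
           \<longlongrightarrow> 0) (at p within \<Omega>)"
proof -
  have op: "open \<Omega>" using assms(1) by (simp add: smooth_bounded_pseudoconvex_domain_def)
  have p: "p \<notin> \<Omega>" using assms(8) op by (simp add: frontier_def interior_open)
  have r0: "(r \<longlongrightarrow> 0) (at p within \<Omega>)"
    using assms(7) at_within_le_to_boundary[OF assms(8)] by (rule tendsto_mono[rotated])
  interpret M: Metric_space "bergman_space \<Omega>" "\<lambda>f g. L2_norm \<Omega> (\<lambda>z. f z - g z)"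
    by (rule Metric_space_bergman[OF op])
  let ?T = "composition_operator \<Omega> \<phi>"
  let ?S = "?T ` {f \<in> bergman_space \<Omega>. L2_norm \<Omega> f < 1}"
  have TA: "?T ` bergman_space \<Omega> \<subseteq> bergman_space \<Omega>"
    and cpt: "compactin M.mtopology (M.mtopology closure_of ?S)"
    using assms(4) by (auto simp: compact_on_bergman_space_def bergman_topology_def)
  have SA: "?S \<subseteq> bergman_space \<Omega>" using TA by blast
  \<comment> \<open>Compactness enters through finite nets: the compact closure is totally bounded,
    and so is its subset \<open>?S\<close>.\<close>
  have tb: "M.mtotally_bounded ?S"
    using M.mtotally_bounded_subset[OF M.compactin_imp_mtotally_bounded[OF cpt]]
      closure_of_subset[of ?S M.mtopology] SA by simp
  show ?thesis
  proof (rule tendstoI)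
    fix e :: real assume e: "0 < e"
    \<comment> \<open>Two errors of \<open>e / 8\<close> will bound the values by
      \<open>e / 4\<close>; the kernel bound doubles this to \<open>e / 2\<close>, which is below
      \<open>e\<close>.\<close>
    have "0 < e / 8" using e by simp
    from tb[unfolded M.mtotally_bounded_def, rule_format, OF this]
    obtain K where K: "finite K" "K \<subseteq> ?S" "?S \<subseteq> (\<Union>g\<in>K. M.mball g (e / 8))"
      by (elim exE conjE)
    have KA: "g \<in> bergman_space \<Omega>" if "g \<in> K" for g
      by (rule subsetD[OF SA subsetD[OF K(2) that]])
    have "\<forall>\<^sub>F \<zeta> in at p within \<Omega>. L2_norm (ball \<zeta> (r \<zeta>)) g < e / 8" if "g \<in> K" for g
    proof (rule order_tendstoD(2)[OF L2_norm_ball_tendsto_0])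
      show "set_integrable lborel \<Omega> (\<lambda>z. (cmod (g z))\<^sup>2)"
        using KA[OF that] by (simp add: bergman_space_def)
      show "\<Omega> \<in> sets borel" using op by simp
      show "0 < e / 8" by fact
    qed (fact r0 assms(6) p)+
    \<comment> \<open>Finiteness of the net gives one neighbourhood of \<open>p\<close> that works
      for all its members.\<close>
    then have "\<forall>\<^sub>F \<zeta> in at p within \<Omega>. \<forall>g\<in>K. L2_norm (ball \<zeta> (r \<zeta>)) g < e / 8"
      using K(1) by (simp add: eventually_ball_finite_distrib)
    moreover have "\<forall>\<^sub>F \<zeta> in at p within \<Omega>. \<zeta> \<in> \<Omega>" by (simp add: eventually_at_filter)
    ultimately show "\<forall>\<^sub>F \<zeta> in at p within \<Omega>.
      dist (L2_norm \<Omega> (bergman_kernel \<Omega> (\<phi> \<zeta>)) * sqrt (measure lborel (ball \<zeta> (r \<zeta>)))) 0 < e"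
    proof eventually_elim
      case (elim \<zeta>)
      let ?c = "sqrt (measure lborel (ball \<zeta> (r \<zeta>)))"
      note sub = assms(6)[OF elim(2)]
      have "cmod (f (\<phi> \<zeta>)) * ?c \<le> e / 4" if f: "f \<in> bergman_space \<Omega>" "L2_norm \<Omega> f < 1" for f
      proof -
        have "?T f \<in> ?S" using f by (intro imageI CollectI conjI)
        from subsetD[OF K(3) this] obtain g where g: "g \<in> K" "?T f \<in> M.mball g (e / 8)"
          by (elim UN_E)
        have TfA: "?T f \<in> bergman_space \<Omega>" using TA imageI[OF f(1)] by (rule subsetD)
        have dA: "(\<lambda>z. g z - ?T f z) \<in> bergman_space \<Omega>"
          by (rule bergman_space_diff[OF op KA[OF g(1)] TfA])
        \<comment> \<open>For \<open>\<zeta>\<close> in \<open>\<Omega>\<close> the value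
          \<open>f (\<phi> \<zeta>)\<close> equals \<open>?T f \<zeta>\<close>, which is compared
          with the nearby net member \<open>g\<close>.\<close>
        have "cmod (f (\<phi> \<zeta>)) \<le> cmod (g \<zeta> - ?T f \<zeta>) + cmod (g \<zeta>)"
          using elim(2) norm_triangle_ineq4[of "g \<zeta>" "g \<zeta> - ?T f \<zeta>"]
          by (simp add: composition_operator_def)
        then have "cmod (f (\<phi> \<zeta>)) * ?c \<le> cmod (g \<zeta> - ?T f \<zeta>) * ?c + cmod (g \<zeta>) * ?c"
          unfolding distrib_right[symmetric] by (rule mult_right_mono) simp
        also have "\<dots> \<le> L2_norm (ball \<zeta> (r \<zeta>)) (\<lambda>z. g z - ?T f z) + L2_norm (ball \<zeta> (r \<zeta>)) g"
          using bergman_mean_value_bound[OF op dA sub] bergman_mean_value_bound[OF op KA[OF g(1)] sub]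
          by (intro add_mono power2_le_imp_le[OF _ L2_norm_nonneg]) (simp_all add: power_mult_distrib)
        \<comment> \<open>The error term is enlarged from the ball to \<open>\<Omega>\<close>, where
          the net estimate holds; \<open>g\<close> stays on the small ball, where its norm is
          already small.\<close>
        also have "\<dots> \<le> L2_norm \<Omega> (\<lambda>z. g z - ?T f z) + e / 8"
        proof (intro add_mono L2_norm_subset_le sub)
          show "set_integrable lborel \<Omega> (\<lambda>z. (cmod (g z - ?T f z))\<^sup>2)"
            using dA by (simp add: bergman_space_def)
          show "L2_norm (ball \<zeta> (r \<zeta>)) g \<le> e / 8"
            using elim(1) g(1) by (simp add: less_imp_le)
        qed simp
        also have "\<dots> \<le> e / 4" using g(2) unfolding M.in_mball by linarith
        finally show ?thesis .
      qed
      then have "L2_norm \<Omega> (bergman_kernel \<Omega> (\<phi> \<zeta>)) * ?c \<le> 2 * (e / 4)"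
        by (intro bergman_kernel_norm_bound[OF op]) simp_all
      also have "\<dots> < e" using e by simp
      finally show ?case by simp
    qed
  qed
qed

end
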